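(* Let $e\geq2$ and $e'\in\{1,\dots,e-1\}$. Let $\alpha=\sum_{i\in\mathbb{Z}/e\mathbb{Z}}c_i\alpha_i\in Q^{0}$. Then $$\sigma\cdot\alpha\in Q^{0}\iff c_0\leq c_{e'}+\mathsf{w}(\alpha),$$ and the inequality on the right-hand side is an equality if and only if $\sigma\cdot\alpha\in Q^{0}_*$. In particular, if $\alpha\in Q^{0}_*$ then $$\sigma\cdot\alpha\in Q^{0}\iff c_0\leq c_{e'},$$ and the inequality on the right-hand side is an equality if and only if $\sigma\cdot\alpha\in Q^{0}_*$.
   Context: A partition is a finite non-increasing sequence $\lambda=(\lambda_1\ge\dots\ge\lambda_h>0)$ of positive integers (possibly empty), with nodes $(a,b)$, $1\le a\le h$, $1\le b\le\lambda_a$. The residue of $(a,b)$ is $b-a\bmod e$; $c_i(\lambda)$ is the number of nodes of residue $i\in\mathbb{Z}/e\mathbb{Z}$. An $e$-core is a partition with no rim hook of length $e$. $Q=\bigoplus_{i\in\mathbb{Z}/e\mathbb{Z}}\mathbb{Z}\alpha_i$ is free abelian with basis $(\alpha_i)$, $\alpha(\lambda):=\sum_ic_i(\lambda)\alpha_i$, $Q^{0}:=\{\alpha(\lambda):\lambda\text{ a partition}\}$ and $Q^{0}_*:=\{\alpha(\lambda):\lambda\text{ an }e\text{-core}\}$. The weight of $\alpha=\sum_ic_i\alpha_i\in Q$ is $\mathsf{w}(\alpha):=c_0-\frac12\sum_{i\in\mathbb{Z}/e\mathbb{Z}}(c_i-c_{i+1})^2$. The map $\sigma:Q\to Q$, $\alpha\mapsto\sigma\cdot\alpha$,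 is the $\mathbb{Z}$-linear map with $\sigma\cdot\alpha_i:=\alpha_{i-e'}$. *)

theory Defs
  imports Complex_Main "HOL-Algebra.Free_Abelian_Groups"
begin

definition partition :: "nat list \<Rightarrow> bool" where
  "partition l \<longleftrightarrow> sorted_wrt (\<ge>) l \<and> (\<forall>x\<in>set l. 0 < x)"

text \<open>Nodes are numbered from 1, whereas list positions are numbered from 0.\<close>

definition nodes :: "nat list \<Rightarrow> (nat \<times> nat) set" where
  "nodes l = {(a, b). 1 \<le> a \<and> a \<le> length l \<and> 1 \<le> b \<and> b \<le> l ! (a - 1)}"

text \<open>The rim hooks of a partition are indexed by its nodes \<open>(a, b)\<close>: each consists of the
  nodes of the rim (those without south-eastern neighbour \<open>(a' + 1, b' + 1)\<close>) lying weakly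
  below and weakly to the right of \<open>(a, b)\<close>. Its length is its number of nodes.\<close>

definition rim_hook :: "nat list \<Rightarrow> nat \<times> nat \<Rightarrow> (nat \<times> nat) set" where
  "rim_hook l = (\<lambda>(a, b). {(a', b') \<in> nodes l.
     a \<le> a' \<and> b \<le> b' \<and> (a' + 1, b' + 1) \<notin> nodes l})"

definition e_core :: "nat \<Rightarrow> nat list \<Rightarrow> bool" where
  "e_core e l \<longleftrightarrow> partition l \<and> \<not> (\<exists>x\<in>nodes l. card (rim_hook l x) = e)"

text \<open>Residue classes modulo \<open>e\<close> are represented by the integers in \<open>{0..<e}\<close>, so that \<open>Q\<close>
  is the free abelian group on this set. The basis vector \<open>simple_root e i\<close> and the coefficient
  \<open>coeff e \<alpha> i\<close> are nevertheless available for every integer \<open>i\<close>, read modulo \<open>e\<close>.\<close>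

definition residue :: "nat \<Rightarrow> nat \<times> nat \<Rightarrow> int" where
  "residue e = (\<lambda>(a, b). (int b - int a) mod int e)"

definition res_count :: "nat \<Rightarrow> nat list \<Rightarrow> int \<Rightarrow> nat" where
  "res_count e l i = card {x \<in> nodes l. residue e x = i}"

definition Q :: "nat \<Rightarrow> (int \<Rightarrow>\<^sub>0 int) set" where
  "Q e = carrier (free_Abelian_group {0..<int e})"

definition simple_root :: "nat \<Rightarrow> int \<Rightarrow> (int \<Rightarrow>\<^sub>0 int)" where
  "simple_root e i = frag_of (i mod int e)"

definition coeff :: "nat \<Rightarrow> (int \<Rightarrow>\<^sub>0 int) \<Rightarrow> int \<Rightarrow> int" where
  "coeff e \<alpha> i = Poly_Mapping.lookup \<alpha> (i mod int e)"

lemma Q_expansion: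
  assumes "\<alpha> \<in> Q e"
  shows "\<alpha> = (\<Sum>i\<in>{0..<int e}. frag_cmul (coeff e \<alpha> i) (simple_root e i))"
proof -
  have "\<alpha> = (\<Sum>i\<in>Poly_Mapping.keys \<alpha>. frag_cmul (Poly_Mapping.lookup \<alpha> i) (frag_of i))"
    using frag_expansion[of \<alpha>] by (simp add: frag_extend_def)
  also have "\<dots> = (\<Sum>i\<in>{0..<int e}. frag_cmul (Poly_Mapping.lookup \<alpha> i) (frag_of i))"
    using assms by (intro sum.mono_neutral_left) (auto simp: Q_def in_keys_iff)
  also have "\<dots> = (\<Sum>i\<in>{0..<int e}. frag_cmul (coeff e \<alpha> i) (simple_root e i))"
    by (intro sum.cong) (auto simp: coeff_def simple_root_def)
  finally show ?thesis .
qed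

definition content :: "nat \<Rightarrow> nat list \<Rightarrow> (int \<Rightarrow>\<^sub>0 int)" where
  "content e l = (\<Sum>i\<in>{0..<int e}. frag_cmul (int (res_count e l i)) (simple_root e i))"

definition Q0 :: "nat \<Rightarrow> (int \<Rightarrow>\<^sub>0 int) set" where
  "Q0 e = {content e l | l. partition l}"

definition Q0_core :: "nat \<Rightarrow> (int \<Rightarrow>\<^sub>0 int) set" where
  "Q0_core e = {content e l | l. e_core e l}"

definition weight :: "nat \<Rightarrow> (int \<Rightarrow>\<^sub>0 int) \<Rightarrow> rat" where
  "weight e \<alpha> = of_int (coeff e \<alpha> 0)
     - 1 / 2 * (\<Sum>i\<in>{0..<int e}. (of_int (coeff e \<alpha> i) - of_int (coeff e \<alpha> (i + 1)))\<^sup>2)"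

definition sigma :: "nat \<Rightarrow> nat \<Rightarrow> (int \<Rightarrow>\<^sub>0 int) \<Rightarrow> (int \<Rightarrow>\<^sub>0 int)" where
  "sigma e e' = frag_extend (\<lambda>i. simple_root e (i - int e'))"

lemma sigma_simple_root: "sigma e e' (simple_root e i) = simple_root e (i - int e')"
  by (simp add: sigma_def simple_root_def mod_diff_left_eq)

lemma content_in_Q:
  assumes "e > 0"
  shows "content e l \<in> Q e"
proof -
  have "Poly_Mapping.keys (content e l)
      \<subseteq> (\<Union>i\<in>{0..<int e}. Poly_Mapping.keys (frag_cmul (int (res_count e l i)) (simple_root e i)))"
    unfolding content_def by (rule keys_sum)
  also have "\<dots> \<subseteq> {0..<int e}"
    using keys_cmul by (auto simp: simple_root_def)
  finally show ?thesis by (simp add: Q_def)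
qed

lemma coeff_content:
  assumes "i \<in> {0..<int e}"
  shows "coeff e (content e l) i = int (res_count e l i)"
proof -
  have "coeff e (content e l) i
      = (\<Sum>j\<in>{0..<int e}. int (res_count e l j) * (if i = j then 1 else 0))"
    using assms unfolding coeff_def content_def
    by (auto simp: lookup_sum simple_root_def intro!: sum.cong)
  also have "\<dots> = int (res_count e l i)"
    using assms by (simp add: if_distrib cong: if_cong)
  finally show ?thesis .
qed

end

theory Submission
  imports Defs
begin

text \<open>The theorem reduces to a description of the two subsets of \<open>Q\<close> by the weight: an element
  \<open>\<alpha>\<close> of \<open>Q\<close> is the content of a partition iff \<open>weight e \<alpha> \<ge> 0\<close>, and it is the content of an
  \<open>e\<close>-core iff \<open>weight e \<alpha> = 0\<close> (\<open>Q0_iff_weight\<close>). Rotating the residues by \<open>e'\<close> only permutes the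
  squares \<open>(c\<^sub>i - c\<^sub>i\<^sub>+\<^sub>1)\<^sup>2\<close> and replaces \<open>c\<^sub>0\<close> by the coefficient at \<open>e'\<close>, so it changes the weight by
  the difference of these two coefficients (\<open>weight_sigma\<close>). The two equivalences therefore say that
  the weight of \<open>\<sigma> \<cdot> \<alpha>\<close> is nonnegative, respectively zero; for a core \<open>\<alpha>\<close> the term
  \<open>weight e \<alpha>\<close> vanishes.

  The description by the weight is read off the abacus. Fill up a partition with zero parts until
  its length is \<open>e * m\<close>, and let \<open>B\<close> be its set of \<open>e * m\<close> beads. A row of the diagram is an
  interval of contents, so counting its nodes of a given residue amounts to subtracting two integer
  quotients by \<open>e\<close>. Summed over the rows, this shows that \<open>c\<^sub>r - c\<^sub>r\<^sub>+\<^sub>1\<close> is the number \<open>n\<^sub>r\<close> of beads on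
  runner \<open>r\<close> minus \<open>m\<close>, and that \<open>c\<^sub>0\<close> is the sum of the heights of all beads up to a constant.
  Hence twice the weight is the sum, over the runners, of twice the sum of the heights minus
  \<open>n\<^sub>r * (n\<^sub>r - 1)\<close> (\<open>double_weight_eq_runner_excess\<close>). The heights on a runner are distinct natural
  numbers; each summand is thus nonnegative, and it vanishes iff the beads of its runner occupy the
  lowest places. This holds for all runners iff no bead can be moved down by \<open>e\<close> into a gap,
  that is, iff there is no rim hook of length \<open>e\<close> (\<open>ex_hook_length_iff_not_flush\<close>).

  Conversely, the differences \<open>c\<^sub>r - c\<^sub>r\<^sub>+\<^sub>1\<close> of any \<open>\<alpha>\<close> in \<open>Q\<close> prescribe the bead numbers of the
  runners, and pushing all beads down gives an \<open>e\<close>-core with the same differences. Its content differs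
  from \<open>\<alpha>\<close> by the same integer \<open>k\<close> at every residue, and \<open>k\<close> is the weight of \<open>\<alpha>\<close> because the core
  has weight zero. If \<open>k \<ge> 0\<close>, lengthening the first row of the core by \<open>e * k\<close> nodes realises \<open>\<alpha>\<close>.\<close>

section \<open>Beads\<close>

text \<open>The usual first-column hook lengths (beta-numbers). The list may end in zeros, which add no nodes:
  the number of beads can thus be made a multiple of any positive number.\<close>

definition bead :: "nat list \<Rightarrow> nat \<Rightarrow> nat" where
  "bead l j = l ! j + (length l - Suc j)"

definition beads :: "nat list \<Rightarrow> nat set" where
  "beads l = bead l ` {..<length l}"

text \<open>The heights \<open>q\<close> of the beads on runner \<open>r\<close> of the abacus with \<open>e\<close> runners.\<close>

definition runner :: "nat \<Rightarrow> nat set \<Rightarrow> nat \<Rightarrow> nat set" where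
  "runner e B r = {q. q * e + r \<in> B}"

definition flush :: "nat \<Rightarrow> nat set \<Rightarrow> bool" where
  "flush e B \<longleftrightarrow> (\<forall>b\<in>B. e \<le> b \<longrightarrow> b - e \<in> B)"

lemma bead_strict_decreasing:
  assumes "sorted_wrt (\<ge>) l" "i < j" "j < length l"
  shows "bead l j < bead l i"
  using sorted_wrt_nth_less[OF assms] assms by (simp add: bead_def)

lemma inj_on_bead: "sorted_wrt (\<ge>) l \<Longrightarrow> inj_on (bead l) {..<length l}"
  by (auto intro!: linorder_inj_onI' dest: bead_strict_decreasing)

lemma finite_beads [simp]: "finite (beads l)"
  by (simp add: beads_def)

lemma card_beads: "sorted_wrt (\<ge>) l \<Longrightarrow> card (beads l) = length l"
  by (simp add: beads_def card_image inj_on_bead)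

lemma bead_Cons: "bead (x # l) 0 = x + length l" "bead (x # l) (Suc j) = bead l j"
  by (auto simp: bead_def)

lemma beads_Cons: "beads (x # l) = insert (x + length l) (beads l)"
  by (simp add: beads_def lessThan_Suc_eq_insert_0 bead_Cons image_image)

text \<open>By induction on the largest bead: it becomes a new first row, whose length is the number of gaps
  below that bead.\<close>

lemma ex_sorted_beads:
  assumes "finite B"
  shows "\<exists>l. sorted_wrt (\<ge>) l \<and> beads l = B"
  using assms
proof (induction rule: finite_linorder_max_induct)
  case empty
  show ?case by (rule exI[of _ "[]"]) (simp add: beads_def)
next
  case (insert b A)
  then obtain l where l: "sorted_wrt (\<ge>) l" "beads l = A" by auto
  have "A \<subseteq> {..<b}" using insert by auto
  then have "card A \<le> b" using card_mono[of "{..<b}" A] by simp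
  then have len: "length l \<le> b" using card_beads[OF l(1)] l(2) by simp
  have "y \<le> b - length l" if "y \<in> set l" for y
  proof (cases l)
    case (Cons x xs)
    have "x + length xs < b" using Cons insert(2) l(2) by (auto simp: beads_Cons)
    moreover have "y \<le> x" using that l Cons by auto
    ultimately show ?thesis using Cons by auto
  qed (use that in auto)
  then show ?case
    using l len by (intro exI[of _ "(b - length l) # l"]) (auto simp: beads_Cons)
qed

section \<open>Runners and flush bead sets\<close>

lemma finite_runner:
  assumes "e > 0" "finite B"
  shows "finite (runner e B r)"
proof -
  have "inj (\<lambda>q. q * e + r)" using assms by (auto simp: inj_on_def)
  then show ?thesis unfolding runner_def
    using finite_vimageI[OF assms(2)] by (simp add: vimage_def)
qed

lemma sum_runners:
  fixes g :: "nat \<Rightarrow> 'a :: comm_monoid_add"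
  assumes "e > 0" "finite B"
  shows "(\<Sum>b\<in>B. g b) = (\<Sum>r<e. \<Sum>q\<in>runner e B r. g (q * e + r))"
proof -
  have "(\<Sum>r<e. \<Sum>q\<in>runner e B r. g (q * e + r)) = (\<Sum>(r,q)\<in>Sigma {..<e} (runner e B). g (q * e + r))"
    using finite_runner[OF assms] by (intro sum.Sigma) auto
  also have "\<dots> = (\<Sum>b\<in>B. g b)"
    using assms
    by (intro sum.reindex_bij_witness[where i = "\<lambda>b. (b mod e, b div e)" and j = "\<lambda>(r,q). q * e + r"])
       (auto simp: runner_def)
  finally show ?thesis by simp
qed

lemma runner_lessThan: "r < e \<Longrightarrow> runner e {..<e * m} r = {..<m}"
proof -
  assume r: "r < e"
  have "q * e + r < e * m \<longleftrightarrow> q < m" for q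
  proof -
    have "q * e + r < e * m \<longleftrightarrow> (q * e + r) div e < m"
      using r by (subst div_less_iff_less_mult) (auto simp: mult.commute)
    then show ?thesis using r by simp
  qed
  then show ?thesis by (auto simp: runner_def)
qed

text \<open>An \<open>n\<close>-element set of natural numbers has at least the sum \<open>0 + \<dots> + (n - 1)\<close>, since its largest
  element is at least \<open>n - 1\<close> and can be split off. Equality forces it to be exactly \<open>n - 1\<close> at every
  stage, so that no number is skipped.\<close>

lemma sum_nat_set_bound:
  fixes A :: "nat set"
  assumes "finite A"
  shows "card A * (card A - 1) \<le> 2 * \<Sum>A \<and> (2 * \<Sum>A = card A * (card A - 1) \<longrightarrow> A = {..<card A})"
  using assms
proof (induction rule: finite_linorder_max_induct)
  case (insert b A)
  have nb: "b \<notin> A" using insert by auto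
  have "A \<subseteq> {..<b}" using insert by auto
  then have le: "card A \<le> b" using card_mono[of "{..<b}" A] by simp
  have s: "2 * \<Sum>(insert b A) = 2 * b + 2 * \<Sum>A" "card (insert b A) = Suc (card A)"
    using nb insert by auto
  have e: "Suc (card A) * (Suc (card A) - 1) = 2 * card A + card A * (card A - 1)"
    by (cases "card A") (auto simp: algebra_simps)
  show ?case unfolding s e
  proof (intro conjI impI)
    assume eq: "2 * b + 2 * \<Sum>A = 2 * card A + card A * (card A - 1)"
    with le insert have "b = card A" "A = {..<card A}" by auto
    then show "insert b A = {..<Suc (card A)}" by (metis lessThan_Suc)
  qed (use le insert in auto)
qed auto

lemma sum_lessThan_nat: "2 * \<Sum>{..<n} = n * (n - 1 :: nat)"
proof (induction n)
  case (Suc n)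
  then show ?case by (cases n) (auto simp: lessThan_Suc algebra_simps)
qed auto

lemma down_closed_nat:
  fixes A :: "nat set"
  assumes "finite A" "\<And>q. Suc q \<in> A \<Longrightarrow> q \<in> A"
  shows "A = {..<card A}"
proof -
  have d: "p \<in> A" if "q \<in> A" "p \<le> q" for p q
    using that(2,1) by (induction rule: inc_induct) (auto intro: assms)
  have "\<exists>n. A = {..<n}"
  proof (cases "A = {}")
    case False
    have "A = {..<Suc (Max A)}" using d[OF Max_in[OF assms(1) False]] assms(1)
      by (auto simp: less_Suc_eq_le)
    then show ?thesis by blast
  qed (auto intro: exI[of _ 0])
  then show ?thesis by auto
qed

lemma flush_iff_runners:
  assumes "e > 0" "finite B"
  shows "flush e B \<longleftrightarrow> (\<forall>r<e. runner e B r = {..<card (runner e B r)})"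
proof
  assume f: "flush e B"
  show "\<forall>r<e. runner e B r = {..<card (runner e B r)}"
  proof (intro allI impI down_closed_nat finite_runner assms)
    fix r q assume "Suc q \<in> runner e B r"
    then have "Suc q * e + r \<in> B" by (simp add: runner_def)
    moreover have "e \<le> Suc q * e + r" by simp
    ultimately have "Suc q * e + r - e \<in> B" using f unfolding flush_def by blast
    then show "q \<in> runner e B r" by (simp add: runner_def)
  qed
next
  assume *: "\<forall>r<e. runner e B r = {..<card (runner e B r)}"
  show "flush e B" unfolding flush_def
  proof (intro ballI impI)
    fix b assume b: "b \<in> B" "e \<le> b"
    define r where "r = b mod e"
    define n where "n = card (runner e B r)"
    have r: "runner e B r = {..<n}" using * assms by (simp add: r_def n_def)
    have "b div e \<in> runner e B r" using b by (simp add: runner_def r_def)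
    then have "b div e - 1 \<in> runner e B r" using r by auto
    moreover have "(b div e - 1) * e + r = b - e"
    proof -
      have "b div e \<ge> 1" using b assms by (simp add: Suc_le_eq div_greater_zero_iff)
      then have "e \<le> b div e * e" using mult_le_mono1[of 1 "b div e" e] by simp
      then have "(b div e - 1) * e + r = b div e * e + r - e" by (simp add: diff_mult_distrib)
      then show ?thesis by (simp add: r_def)
    qed
    ultimately show "b - e \<in> B" by (simp add: runner_def)
  qed
qed

section \<open>Hook lengths and beads\<close>

text \<open>The rim hook of the node \<open>(i + 1, b)\<close> occupies the rows \<open>i + 1\<close> to \<open>k + 1\<close>, where row \<open>k + 1\<close> is
  the last one of length at least \<open>b\<close>. In each of them the rim is an interval of columns which starts
  where the next row ends, except that in the last row it is cut off at \<open>b\<close>. The sizes of these intervals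
  telescope to the usual hook length, arm plus leg plus one.\<close>

lemma card_rim_hook:
  assumes l: "sorted_wrt (\<ge>) l" and ik: "i \<le> k" "k < length l"
    and b: "1 \<le> b" "b \<le> l ! k" and last: "Suc k < length l \<Longrightarrow> l ! Suc k < b"
  shows "card (rim_hook l (Suc i, b)) + b + i = l ! i + k + 1"
proof -
  \<comment> \<open>The row lengths, except that the first row below the hook counts as \<open>b\<close>: with this convention
    row \<open>j + 1\<close> contributes the columns \<open>f (j + 1)\<close> to \<open>f j\<close> whenever \<open>i \<le> j \<le> k\<close>.\<close>
  define f where "f j = (if j = Suc k then b else l ! j)" for j
  have anti: "l ! q \<le> l ! p" if "p \<le> q" "q < length l" for p q
    using sorted_wrt_nth_less[OF l, of p q] that by (cases "p = q") auto
  have fb: "b \<le> f j" "f (Suc j) \<le> f j" if "j \<le> k" for j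
    using that ik b anti[of j k] anti[of j "Suc j"] by (auto simp: f_def not_less_eq_eq)
  have small: "l ! q < b" if "k < q" "q < length l" for q
    using anti[of "Suc k" q] last that by auto
  have eq: "rim_hook l (Suc i, b) = (\<Union>j\<in>{i..k}. Pair (Suc j) ` {f (Suc j)..f j})" (is "?L = ?R")
  proof (rule Set.set_eqI)
    fix x :: "nat \<times> nat"
    obtain p c where x: "x = (p, c)" by force
    have "x \<in> ?L \<longleftrightarrow> (\<exists>j. p = Suc j \<and> i \<le> j \<and> j < length l \<and> b \<le> c \<and> c \<le> l ! j
              \<and> (Suc j < length l \<longrightarrow> l ! Suc j \<le> c))"
      using b x by (cases p) (auto simp: rim_hook_def nodes_def Suc_le_eq not_le)
    also have "\<dots> \<longleftrightarrow> (\<exists>j. p = Suc j \<and> i \<le> j \<and> j \<le> k \<and> f (Suc j) \<le> c \<and> c \<le> f j)"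
    proof -
      have "(j < length l \<and> b \<le> c \<and> c \<le> l ! j \<and> (Suc j < length l \<longrightarrow> l ! Suc j \<le> c))
         \<longleftrightarrow> (j \<le> k \<and> f (Suc j) \<le> c \<and> c \<le> f j)" for j
      proof (cases "j \<le> k")
        case True
        then show ?thesis using fb[of "Suc j"] ik last
          by (cases "j = k") (auto simp: f_def)
      next
        case False
        then show ?thesis using small[of j] by auto
      qed
      then show ?thesis by metis
    qed
    also have "\<dots> \<longleftrightarrow> x \<in> ?R" unfolding x by force
    finally show "x \<in> ?L \<longleftrightarrow> x \<in> ?R" .
  qed
  have "card ?L = (\<Sum>j\<in>{i..k}. card (Pair (Suc j) ` {f (Suc j)..f j}))"
    unfolding eq by (subst card_UN_disjoint) auto
  also have "\<dots> = (\<Sum>j\<in>{i..k}. Suc (f j) - f (Suc j))"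
    by (intro sum.cong refl) (auto simp: card_image inj_on_def)
  finally have "int (card ?L) = (\<Sum>j=i..k. (int (f j) - int (f (Suc j))) + 1)"
    using fb by (auto intro!: sum.cong simp: of_nat_diff le_SucI)
  also have "\<dots> = (\<Sum>j=i..k. - int (f (Suc j)) - - int (f j)) + int (Suc k - i)"
    by (simp add: sum.distrib)
  also have "(\<Sum>j=i..k. - int (f (Suc j)) - - int (f j)) = int (f i) - int (f (Suc k))"
    using ik by (subst sum_Suc_diff) auto
  finally have "int (card ?L) = int (l ! i) - int b + int (Suc k - i)"
    using ik by (simp add: f_def)
  then show ?thesis using ik by simp
qed

text \<open>With \<open>k\<close> as in \<open>card_rim_hook\<close>, the hook length of \<open>(i + 1, b)\<close> is the distance from bead \<open>i\<close> down
  to the position \<open>x = b + length l - k - 2\<close>. This position is a gap, because it lies strictly between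
  the beads \<open>k + 1\<close> and \<open>k\<close>, or below all beads if \<open>k\<close> is the last one. Conversely a gap \<open>x\<close> below bead \<open>i\<close> determines \<open>k\<close>, the last bead
  above \<open>x\<close>, and then \<open>b\<close>.\<close>

lemma ex_hook_length_iff_not_flush:
  assumes l: "sorted_wrt (\<ge>) l" and e: "e > 0"
  shows "(\<exists>x\<in>nodes l. card (rim_hook l x) = e) \<longleftrightarrow> \<not> flush e (beads l)"
proof
  assume "\<exists>x\<in>nodes l. card (rim_hook l x) = e"
  then obtain a b where ab: "(a, b) \<in> nodes l" "card (rim_hook l (a, b)) = e" by auto
  define i where "i = a - 1"
  have i: "a = Suc i" "i < length l" "1 \<le> b" "b \<le> l ! i" using ab by (auto simp: nodes_def i_def)
  define k where "k = Max {j. j < length l \<and> b \<le> l ! j}"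
  have "k \<in> {j. j < length l \<and> b \<le> l ! j}" unfolding k_def using i by (intro Max_in) auto
  then have k: "k < length l" "b \<le> l ! k" by auto
  have kmax: "j \<le> k" if "j < length l" "b \<le> l ! j" for j
    unfolding k_def using that by (intro Max_ge) auto
  have ik: "i \<le> k" using kmax i by auto
  have last: "l ! Suc k < b" if "Suc k < length l" using kmax[OF that] by force
  have len: "e + b + i = l ! i + k + 1" using card_rim_hook[OF l ik k(1) i(3) k(2) last] ab i by simp
  have be: "bead l i - e + k + 2 = b + length l" "e \<le> bead l i"
    using len ik k i by (auto simp: bead_def)
  have "bead l j \<noteq> bead l i - e" if "j < length l" for j
  proof (cases "j \<le> k")
    case True
    then have "bead l k \<le> bead l j" using bead_strict_decreasing[OF l, of j k] k by (cases "j = k") auto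
    moreover have "bead l k \<ge> b + (length l - Suc k)" using k by (simp add: bead_def)
    ultimately show ?thesis using be k by simp
  next
    case False
    then have "l ! j < b" using kmax that by force
    then show ?thesis using be False that by (simp add: bead_def)
  qed
  then show "\<not> flush e (beads l)"
    using be i unfolding flush_def beads_def by fastforce
next
  assume "\<not> flush e (beads l)"
  then obtain i where i': "i < length l" "e \<le> bead l i" "bead l i - e \<notin> beads l"
    by (auto simp: flush_def beads_def)
  define x where "x = bead l i - e"
  have i: "i < length l" "bead l i = x + e"
    using i' by (simp_all add: x_def)
  have x: "bead l j \<noteq> x" if "j < length l" for j
    using i'(3) that unfolding beads_def x_def[symmetric] by auto
  define k where "k = Max {j. j < length l \<and> x < bead l j}"
  have "k \<in> {j. j < length l \<and> x < bead l j}" unfolding k_def using i e by (intro Max_in) auto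
  then have k: "k < length l" "x < bead l k" by auto
  have kmax: "j \<le> k" if "j < length l" "x < bead l j" for j
    unfolding k_def using that by (intro Max_ge) auto
  have ik: "i \<le> k" using kmax i e by auto
  have last: "bead l (Suc k) < x" if "Suc k < length l" using kmax[OF that] x[OF that] by force
  define b where "b = x + k + 2 - length l"
  have b: "b + length l = x + k + 2" "1 \<le> b"
    using last k by (cases "Suc k < length l"; auto simp: b_def bead_def)+
  have bk: "b \<le> l ! k" using b k by (simp add: bead_def)
  have bl: "l ! Suc k < b" if "Suc k < length l" using last[OF that] that b by (simp add: bead_def)
  have "card (rim_hook l (Suc i, b)) = e"
    using card_rim_hook[OF l ik k(1) b(2) bk bl] b i by (simp add: bead_def)
  moreover have "(Suc i, b) \<in> nodes l"
    using b bk ik i sorted_wrt_nth_less[OF l, of i k] k by (cases "i = k") (auto simp: nodes_def)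
  ultimately show "\<exists>x\<in>nodes l. card (rim_hook l x) = e" by blast
qed


section \<open>Counting residues by beads\<close>

lemma int_div_step:
  fixes x :: int and e :: nat
  assumes "e > 0"
  shows "(x + 1) div int e = x div int e + (if (x + 1) mod int e = 0 then 1 else 0)"
proof -
  have "x mod int e < int e" "x mod int e \<ge> 0" using assms by auto
  then have m: "(x + 1) mod int e = (if x mod int e + 1 = int e then 0 else x mod int e + 1)"
    using mod_add_left_eq[of x "int e" 1] by auto
  have "x + 1 = (x + 1) div int e * int e + (x + 1) mod int e" by simp
  moreover have "x = x div int e * int e + x mod int e" by simp
  ultimately have "((x + 1) div int e - x div int e) * int e = 1 + x mod int e - (x + 1) mod int e"
    by (simp add: algebra_simps)
  moreover have "\<dots> = (if (x + 1) mod int e = 0 then int e else 0)"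
    using m \<open>x mod int e \<ge> 0\<close> by auto
  ultimately show ?thesis using assms by (auto split: if_splits simp del: mod_add_self1)
qed

lemma card_residue_interval:
  fixes u i :: int
  assumes "e > 0"
  shows "int (card {b \<in> {1..n}. (int b + u) mod int e = i mod int e})
       = (int n + u - i) div int e - (u - i) div int e"
proof (induction n)
  case (Suc n)
  have "{b \<in> {1..Suc n}. (int b + u) mod int e = i mod int e} =
    {b \<in> {1..n}. (int b + u) mod int e = i mod int e} \<union>
     (if (int (Suc n) + u) mod int e = i mod int e then {Suc n} else {})"
    by (auto simp: le_Suc_eq)
  then have "int (card {b \<in> {1..Suc n}. (int b + u) mod int e = i mod int e})
     = int (card {b \<in> {1..n}. (int b + u) mod int e = i mod int e})
       + (if (int (Suc n) + u) mod int e = i mod int e then 1 else 0)"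
    by simp
  moreover have "(int (Suc n) + u) mod int e = i mod int e \<longleftrightarrow> (int n + u - i + 1) mod int e = 0"
    by (simp add: mod_eq_dvd_iff dvd_eq_mod_eq_0 [symmetric] algebra_simps)
  moreover have "int (Suc n) + u - i = int n + u - i + 1" by simp
  ultimately show ?case using Suc int_div_step[OF assms, of "int n + u - i"] by (simp only:)
qed auto

lemma coeff_mod: "coeff e \<alpha> (i mod int e) = coeff e \<alpha> i"
  by (simp add: coeff_def)

text \<open>The contents in row \<open>j + 1\<close> form the interval from \<open>- j\<close> to \<open>l ! j - j - 1\<close>. Shifting by the length
  of \<open>l\<close>, a multiple of \<open>e\<close>, turns its end into bead \<open>j\<close> of \<open>l\<close> and the number before its start into
  bead \<open>j\<close> of the empty partition, without changing the difference of the quotients.\<close>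

lemma coeff_content_beads:
  assumes "e > 0" and "e dvd length l"
  shows "coeff e (content e l) i = (\<Sum>j<length l.
     (int (bead l j) - i) div int e - (int (length l - Suc j) - i) div int e)"
proof -
  let ?N = "length l"
  have "{x \<in> nodes l. residue e x = i mod int e} =
     (\<Union>j<?N. Pair (Suc j) ` {b \<in> {1..l!j}. (int b + (- int (Suc j))) mod int e = i mod int e})"
    (is "?L = ?R")
  proof (rule Set.set_eqI)
    fix x :: "nat \<times> nat"
    obtain a b where x: "x = (a, b)" by force
    show "x \<in> ?L \<longleftrightarrow> x \<in> ?R"
      by (cases a) (auto simp: x nodes_def residue_def image_iff Suc_le_eq algebra_simps)
  qed
  then have "card ?L = (\<Sum>j<?N. card (Pair (Suc j) ` {b \<in> {1..l!j}. (int b + (- int (Suc j))) mod int e = i mod int e}))"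
    by (simp, subst card_UN_disjoint) auto
  also have "\<dots> = (\<Sum>j<?N. card {b \<in> {1..l!j}. (int b + (- int (Suc j))) mod int e = i mod int e})"
    by (intro sum.cong card_image) (auto simp: inj_on_def)
  finally have "int (card ?L) = (\<Sum>j<?N. (int (l!j) + (- int (Suc j)) - i) div int e - (- int (Suc j) - i) div int e)"
    using card_residue_interval[OF assms(1)] by simp
  also have "\<dots> = (\<Sum>j<?N. (int (bead l j) - i) div int e - (int (length l - Suc j) - i) div int e)"
  proof (intro sum.cong refl)
    fix j assume "j \<in> {..<?N}"
    then have j: "int (?N - Suc j) = int ?N - int (Suc j)" by auto
    obtain m where m: "?N = e * m" using assms(2) by auto
    have *: "(int ?N + x) div int e = int m + x div int e" for x
      using assms(1) m by simp
    show "(int (l!j) + (- int (Suc j)) - i) div int e - (- int (Suc j) - i) div int e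
      = (int (bead l j) - i) div int e - (int (length l - Suc j) - i) div int e"
      using *[of "int (l!j) + (- int (Suc j)) - i"] *[of "- int (Suc j) - i"]
      by (simp add: bead_def j algebra_simps)
  qed
  finally show ?thesis
    using assms(1) coeff_content[of "i mod int e" e l] by (simp add: coeff_mod res_count_def)
qed

section \<open>The weight on the abacus\<close>

text \<open>Twice the number of steps by which the beads can be pushed down along their runners.\<close>

definition runner_excess :: "nat \<Rightarrow> nat set \<Rightarrow> int" where
  "runner_excess e B = (\<Sum>r<e. 2 * int (\<Sum>(runner e B r))
     - int (card (runner e B r) * (card (runner e B r) - 1)))"

lemma runner_excess_nonneg_flush:
  assumes "e > 0" "finite B"
  shows "0 \<le> runner_excess e B" "runner_excess e B = 0 \<longleftrightarrow> flush e B"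
proof -
  define x where "x r = 2 * int (\<Sum>(runner e B r))
     - int (card (runner e B r) * (card (runner e B r) - 1))" for r
  have x: "0 \<le> x r" "x r = 0 \<longleftrightarrow> runner e B r = {..<card (runner e B r)}" for r
  proof -
    have *: "2 * int (\<Sum>A) = int (2 * \<Sum>A)" for A by simp
    note b = sum_nat_set_bound[OF finite_runner[OF assms, of r]]
    show "0 \<le> x r" using b unfolding x_def * by linarith
    show "x r = 0 \<longleftrightarrow> runner e B r = {..<card (runner e B r)}"
    proof
      assume "x r = 0"
      then show "runner e B r = {..<card (runner e B r)}" using b unfolding x_def * by linarith
    next
      assume a: "runner e B r = {..<card (runner e B r)}"
      define n where "n = card (runner e B r)"
      have "runner e B r = {..<n}" using a by (simp add: n_def)
      then show "x r = 0" unfolding x_def * using sum_lessThan_nat[of n] by simp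
    qed
  qed
  have e: "runner_excess e B = (\<Sum>r<e. x r)" by (simp add: runner_excess_def x_def)
  show "0 \<le> runner_excess e B" unfolding e by (intro sum_nonneg x)
  show "runner_excess e B = 0 \<longleftrightarrow> flush e B" unfolding e
    by (subst sum_nonneg_eq_0_iff) (auto simp: x flush_iff_runners[OF assms])
qed

lemma coeff_content_bead_set:
  assumes "sorted_wrt (\<ge>) l" "e > 0" "length l = e * m"
  shows "coeff e (content e l) i
    = (\<Sum>b\<in>beads l. (int b - i) div int e) - (\<Sum>b<e * m. (int b - i) div int e)"
proof -
  have "coeff e (content e l) i = (\<Sum>j<length l. (int (bead l j) - i) div int e)
     - (\<Sum>j<length l. (int (length l - Suc j) - i) div int e)"
    using coeff_content_beads[of e l i] assms by (simp add: sum_subtractf)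
  also have "(\<Sum>j<length l. (int (bead l j) - i) div int e) = (\<Sum>b\<in>beads l. (int b - i) div int e)"
    unfolding beads_def by (subst sum.reindex[OF inj_on_bead[OF assms(1)]]) simp
  also have "(\<Sum>j<length l. (int (length l - Suc j) - i) div int e) = (\<Sum>b<e * m. (int b - i) div int e)"
    using sum.nat_diff_reindex[of "\<lambda>j. (int j - i) div int e" "length l"] assms by simp
  finally show ?thesis .
qed

text \<open>Passing from \<open>r\<close> to \<open>r + 1\<close> lowers the quotient \<open>(b - r) div e\<close> by one exactly for the beads on
  runner \<open>r\<close>. The empty partition, which is subtracted, has \<open>m\<close> beads on each runner.\<close>

lemma coeff_diff_eq_runner:
  assumes "sorted_wrt (\<ge>) l" "e > 0" "length l = e * m" "r < e"
  shows "coeff e (content e l) (int r) - coeff e (content e l) (int r + 1)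
       = int (card (runner e (beads l) r)) - int m"
proof -
  have step: "(int b - int r) div int e - (int b - (int r + 1)) div int e = (if b mod e = r then 1 else 0)" for b
  proof -
    have "(int b - int r) mod int e = 0 \<longleftrightarrow> int b mod int e = int r mod int e"
      by (simp add: mod_eq_dvd_iff dvd_eq_mod_eq_0)
    also have "\<dots> \<longleftrightarrow> b mod e = r"
      using assms by (simp flip: of_nat_mod)
    finally show ?thesis using int_div_step[OF assms(2), of "int b - (int r + 1)"]
      by simp
  qed
  have count: "(\<Sum>b\<in>B. (int b - int r) div int e) - (\<Sum>b\<in>B. (int b - (int r + 1)) div int e)
     = int (card (runner e B r))" if "finite B" for B
  proof -
    have "(\<Sum>b\<in>B. (int b - int r) div int e) - (\<Sum>b\<in>B. (int b - (int r + 1)) div int e)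
      = (\<Sum>b\<in>B. if b mod e = r then 1 else 0)"
      by (simp only: step flip: sum_subtractf)
    also have "\<dots> = (\<Sum>s<e. \<Sum>q\<in>runner e B s. if s = r then 1 else 0)"
      by (subst sum_runners[OF assms(2) that]) (auto intro!: sum.cong)
    also have "\<dots> = (\<Sum>s<e. if s = r then int (card (runner e B s)) else 0)"
      by (intro sum.cong) auto
    also have "\<dots> = int (card (runner e B r))" using assms(4) by simp
    finally show ?thesis .
  qed
  show ?thesis
    using count[of "beads l"] count[of "{..<e*m}"] assms(4)
    by (simp add: coeff_content_bead_set[OF assms(1-3)] runner_lessThan)
qed

lemma coeff_0_eq_runner_sums:
  assumes "sorted_wrt (\<ge>) l" "e > 0" "length l = e * m"
  shows "2 * coeff e (content e l) 0
     = (\<Sum>r<e. 2 * int (\<Sum>(runner e (beads l) r))) - int e * (int m * (int m - 1))"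
proof -
  have *: "(\<Sum>b\<in>B. (int b - 0) div int e) = (\<Sum>r<e. int (\<Sum>(runner e B r)))" if "finite B" for B
    by (subst sum_runners[OF assms(2) that])
       (auto intro!: sum.cong simp: of_nat_div [symmetric] simp del: of_nat_add of_nat_mult)
  have "2 * int (\<Sum>{..<m}) = int (2 * \<Sum>{..<m})" by simp
  also have "\<dots> = int m * (int m - 1)"
    unfolding sum_lessThan_nat by (cases m) (auto simp: algebra_simps)
  finally have m: "2 * int (\<Sum>{..<m}) = int m * (int m - 1)" .
  have "coeff e (content e l) 0 = (\<Sum>r<e. int (\<Sum>(runner e (beads l) r))) - (\<Sum>r<e. int (\<Sum>(runner e {..<e * m} r)))"
    unfolding coeff_content_bead_set[OF assms] by (subst (1 2) *) auto
  also have "(\<Sum>r<e. int (\<Sum>(runner e {..<e * m} r))) = int e * int (\<Sum>{..<m})"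
    by (simp add: runner_lessThan)
  finally have "2 * coeff e (content e l) 0
     = 2 * (\<Sum>r<e. int (\<Sum>(runner e (beads l) r))) - int e * (2 * int (\<Sum>{..<m}))"
    by (simp only: right_diff_distrib mult.left_commute)
  then show ?thesis unfolding m sum_distrib_left .
qed

definition double_weight :: "nat \<Rightarrow> (int \<Rightarrow>\<^sub>0 int) \<Rightarrow> int" where
  "double_weight e \<alpha> = 2 * coeff e \<alpha> 0 - (\<Sum>i\<in>{0..<int e}. (coeff e \<alpha> i - coeff e \<alpha> (i + 1))\<^sup>2)"

lemma weight_eq_double_weight: "weight e \<alpha> = of_int (double_weight e \<alpha>) / 2"
  by (simp add: weight_def double_weight_def diff_divide_distrib)

lemma sum_residues: "(\<Sum>i\<in>{0..<int e}. f i) = (\<Sum>r<e. f (int r))"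
  using image_int_atLeastLessThan[of 0 e] sum.reindex[of int "{..<e}" f]
  by (simp add: atLeast0LessThan)

text \<open>Expanding \<open>(n\<^sub>r - m)\<^sup>2\<close>, where \<open>n\<^sub>r\<close> is the number of beads on runner \<open>r\<close>, and using that the \<open>n\<^sub>r\<close>
  add up to \<open>e * m\<close>, all terms in \<open>m\<close> cancel against the contribution of the empty partition
  to \<open>c\<^sub>0\<close>.\<close>

lemma double_weight_eq_runner_excess:
  assumes "sorted_wrt (\<ge>) l" "e > 0" "length l = e * m"
  shows "double_weight e (content e l) = runner_excess e (beads l)"
proof -
  define n where "n r = int (card (runner e (beads l) r))" for r
  have tot: "(\<Sum>r<e. n r) = int e * int m"
    using sum_runners[OF assms(2), of "beads l" "\<lambda>_. 1::int"] assms card_beads[OF assms(1)]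
    by (simp add: n_def)
  have "(\<Sum>i\<in>{0..<int e}. (coeff e (content e l) i - coeff e (content e l) (i + 1))\<^sup>2)
     = (\<Sum>r<e. (n r - int m)\<^sup>2)"
    unfolding sum_residues n_def using coeff_diff_eq_runner[OF assms] by simp
  also have "\<dots> = (\<Sum>r<e. (n r)\<^sup>2) - 2 * int m * (\<Sum>r<e. n r) + int e * (int m)\<^sup>2"
    by (simp add: power2_diff sum.distrib sum_subtractf sum_distrib_left algebra_simps)
  finally have sq: "(\<Sum>i\<in>{0..<int e}. (coeff e (content e l) i - coeff e (content e l) (i + 1))\<^sup>2)
     = (\<Sum>r<e. (n r)\<^sup>2) - int e * (int m)\<^sup>2" 
    by (simp add: tot power2_eq_square)
  have "int (card A * (card A - 1)) = (int (card A))\<^sup>2 - int (card A)" for A :: "nat set"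
    by (cases "card A") (auto simp: power2_eq_square algebra_simps)
  then have "runner_excess e (beads l)
      = (\<Sum>r<e. 2 * int (\<Sum>(runner e (beads l) r))) - ((\<Sum>r<e. (n r)\<^sup>2) - (\<Sum>r<e. n r))"
    unfolding runner_excess_def n_def by (simp only: sum_subtractf)
  then show ?thesis
    unfolding double_weight_def coeff_0_eq_runner_sums[OF assms] sq tot
    by (simp add: power2_eq_square algebra_simps)
qed

section \<open>Partitions and lists with trailing zeros\<close>

lemma nodes_append_zeros: "nodes (l @ replicate k 0) = nodes l"
proof (rule Set.set_eqI)
  fix x :: "nat \<times> nat"
  obtain a b where "x = (a, b)" by force
  then show "x \<in> nodes (l @ replicate k 0) \<longleftrightarrow> x \<in> nodes l"
    by (cases a) (auto simp: nodes_def nth_append split: if_splits)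
qed

lemma sorted_eq_append_zeros:
  "sorted_wrt (\<ge>) l \<Longrightarrow> \<exists>k. l = filter (\<lambda>x. 0 < x) l @ replicate k (0::nat)"
proof (induction l)
  case (Cons x l)
  show ?case
  proof (cases "x = 0")
    case True
    then have "\<forall>y\<in>set (x # l). y = 0" using Cons by auto
    then have "filter (\<lambda>x. 0 < x) (x # l) = []" "x # l = replicate (length (x # l)) 0"
      by (auto simp: filter_empty_conv intro!: replicate_eqI)
    then show ?thesis by (metis append_Nil)
  qed (use Cons in auto)
qed auto

lemma partition_of_sorted:
  assumes "sorted_wrt (\<ge>) l"
  obtains p where "partition p" "nodes p = nodes l"
proof
  show "partition (filter (\<lambda>x. 0 < x) l)"
    using assms by (auto simp: partition_def intro: sorted_wrt_filter)
  show "nodes (filter (\<lambda>x. 0 < x) l) = nodes l"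
    using sorted_eq_append_zeros[OF assms] nodes_append_zeros by metis
qed

lemma padded_partition:
  assumes "partition p" "e > 0"
  obtains l m where "sorted_wrt (\<ge>) l" "length l = e * Suc m" "nodes l = nodes p"
proof
  let ?l = "p @ replicate (e * Suc (length p) - length p) 0"
  have "length p \<le> e * Suc (length p)" using assms(2) by (cases e) auto
  then show "length ?l = e * Suc (length p)" by simp
  show "sorted_wrt (\<ge>) ?l" using assms(1)
    by (auto simp: partition_def sorted_wrt_append sorted_wrt_iff_nth_less[of _ "replicate _ _"])
  show "nodes ?l = nodes p" by (rule nodes_append_zeros)
qed

lemma content_cong: "nodes p = nodes l \<Longrightarrow> content e p = content e l"
  by (simp add: content_def res_count_def)

lemma e_core_iff_flush:
  assumes "partition p" "nodes p = nodes l" "sorted_wrt (\<ge>) l" "e > 0"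
  shows "e_core e p \<longleftrightarrow> flush e (beads l)"
  using ex_hook_length_iff_not_flush[OF assms(3,4)] assms(1,2)
  by (simp add: e_core_def rim_hook_def)

section \<open>Elements realised by partitions and by cores\<close>

lemma weight_content_partition:
  assumes "partition p" "e > 0"
  shows "0 \<le> weight e (content e p)" "weight e (content e p) = 0 \<longleftrightarrow> e_core e p"
proof -
  obtain l m where l: "sorted_wrt (\<ge>) l" "length l = e * Suc m" "nodes l = nodes p"
    using padded_partition[OF assms] .
  have w: "weight e (content e p) = of_int (runner_excess e (beads l)) / 2"
    using double_weight_eq_runner_excess[OF l(1) assms(2) l(2)] content_cong[OF l(3)]
    by (simp add: weight_eq_double_weight)
  show "0 \<le> weight e (content e p)" "weight e (content e p) = 0 \<longleftrightarrow> e_core e p"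
    unfolding w e_core_iff_flush[OF assms(1) l(3)[symmetric] l(1) assms(2)]
    using runner_excess_nonneg_flush[OF assms(2), of "beads l"] by auto
qed

text \<open>Lengthening the first row by \<open>e * k\<close> nodes adds \<open>k\<close> full cycles of residues. A list padded to
  positive length has a first row even if the partition is empty.\<close>

lemma ex_partition_add_delta:
  assumes "partition p" "e > 0"
  obtains p' where "partition p'"
    "\<And>i. coeff e (content e p') i = coeff e (content e p) i + int k"
proof -
  obtain l m where l: "sorted_wrt (\<ge>) l" "length l = e * Suc m" "nodes l = nodes p"
    using padded_partition[OF assms] .
  obtain x xs where x: "l = x # xs" using l(2) assms(2) by (cases l) auto
  let ?l = "(x + e * k) # xs"
  have s: "sorted_wrt (\<ge>) ?l" using l(1) x by auto
  obtain p' where p': "partition p'" "nodes p' = nodes ?l" using partition_of_sorted[OF s] .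
  have len: "length l = Suc (length xs)" "length ?l = Suc (length xs)" using x by auto
  have d: "e dvd length l" "e dvd length ?l" using l(2) len by auto
  have "coeff e (content e ?l) i = coeff e (content e l) i + int k" for i
  proof -
    have "(int (bead ?l 0) - i) div int e = (int (bead l 0) - i + int k * int e) div int e"
      by (simp add: x bead_Cons algebra_simps)
    also have "\<dots> = (int (bead l 0) - i) div int e + int k" using assms(2) by simp
    finally show ?thesis
      unfolding coeff_content_beads[OF assms(2) d(1)] coeff_content_beads[OF assms(2) d(2)] len sum.lessThan_Suc_shift
      by (simp add: x bead_Cons)
  qed
  then show thesis using that[OF p'(1)] content_cong[OF p'(2)] content_cong[OF l(3)] by simp
qed

lemma sum_periodic_shift:
  fixes f :: "int \<Rightarrow> 'a :: comm_monoid_add"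
  assumes "e > 0" "\<And>i. f (i mod int e) = f i"
  shows "(\<Sum>i\<in>{0..<int e}. f (i + c)) = (\<Sum>i\<in>{0..<int e}. f i)"
  using assms
  by (intro sum.reindex_bij_witness[where i = "\<lambda>j. (j - c) mod int e" and j = "\<lambda>j. (j + c) mod int e"])
     (auto simp: mod_diff_left_eq mod_add_left_eq)

text \<open>Put \<open>m + c\<^sub>r - c\<^sub>r\<^sub>+\<^sub>1\<close> beads on the lowest places of runner \<open>r\<close>, where \<open>m\<close> is large enough for these
  numbers to be nonnegative. The differences sum to zero around the cycle, so there are \<open>e * m\<close> beads in
  all, and the resulting core has the differences of \<open>\<alpha>\<close>. Two coefficient families with the same
  successive differences differ by a constant.\<close>

lemma ex_core_same_differences:
  assumes "e > 0"
  obtains p k where "e_core e p" "\<And>i. coeff e \<alpha> i = coeff e (content e p) i + k"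
proof -
  define d where "d i = coeff e \<alpha> i - coeff e \<alpha> (i + 1)" for i
  have d_sum: "(\<Sum>r<e. d (int r)) = 0"
    using sum_periodic_shift[OF assms, of "coeff e \<alpha>" 1]
    unfolding sum_residues[symmetric] by (simp add: d_def coeff_mod sum_subtractf)
  define m where "m = nat (\<Sum>r<e. \<bar>d (int r)\<bar>)"
  define n where "n r = nat (int m + d (int r))" for r
  have n: "int (n r) = int m + d (int r)" if "r < e" for r
  proof -
    have "\<bar>d (int r)\<bar> \<le> (\<Sum>r<e. \<bar>d (int r)\<bar>)" using that by (intro member_le_sum) auto
    moreover have "- d (int r) \<le> \<bar>d (int r)\<bar>" by simp
    ultimately have "0 \<le> int m + d (int r)" by (simp add: m_def)
    then show ?thesis by (simp add: n_def)
  qed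
  define B where "B = {b. b div e < n (b mod e)}"
  have run: "runner e B r = {..<n r}" if "r < e" for r
    using that by (auto simp: runner_def B_def)
  have "b < e * (\<Sum>r<e. n r)" if "b \<in> B" for b
  proof -
    have "n (b mod e) \<le> (\<Sum>r<e. n r)" using assms by (intro member_le_sum) auto
    then have "b div e < (\<Sum>r<e. n r)" using that by (simp add: B_def)
    then show ?thesis using assms by (simp add: div_less_iff_less_mult mult.commute)
  qed
  then have fin: "finite B" using finite_subset[of B "{..<e * (\<Sum>r<e. n r)}"] by auto
  obtain l where l: "sorted_wrt (\<ge>) l" "beads l = B" using ex_sorted_beads[OF fin] by auto
  have "int (length l) = (\<Sum>r<e. int (n r))"
    using card_beads[OF l(1)] l(2) sum_runners[OF assms fin, of "\<lambda>_. 1::nat"] by (simp add: run)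
  also have "\<dots> = (\<Sum>r<e. int m + d (int r))" by (intro sum.cong) (auto simp: n)
  also have "\<dots> = int (e * m)" by (simp add: sum.distrib d_sum)
  finally have len: "length l = e * m" by linarith
  obtain p where p: "partition p" "nodes p = nodes l" using partition_of_sorted[OF l(1)] .
  have "e_core e p"
    using e_core_iff_flush[OF p l(1) assms] flush_iff_runners[OF assms fin] l(2) run by simp
  moreover define k where "k i = coeff e \<alpha> i - coeff e (content e p) i" for i
  have step: "k (i + 1) = k i" for i
  proof -
    have per: "k (i mod int e) = k i" "k (i mod int e + 1) = k (i + 1)" for i
      by (simp_all add: k_def coeff_def mod_add_left_eq)
    define r where "r = nat (i mod int e)"
    have r: "int r = i mod int e" "r < e" using assms by (auto simp: r_def nat_less_iff)
    have "coeff e (content e p) (int r) - coeff e (content e p) (int r + 1) = d (int r)"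
      using coeff_diff_eq_runner[OF l(1) assms len r(2)] run[OF r(2)] n[OF r(2)] l(2) content_cong[OF p(2)]
      by simp
    then have "k (int r) = k (int r + 1)" by (simp add: k_def d_def)
    then show ?thesis unfolding r(1) per by simp
  qed
  have "k i = k 0" for i
  proof (induction i rule: int_induct[where k = 0])
    case (step2 i)
    then show ?case using step[of "i - 1"] by simp
  qed (simp_all add: step)
  ultimately show thesis using that[of p "k 0"] by (simp add: k_def algebra_simps)
qed

lemma Q_eqI:
  assumes "\<alpha> \<in> Q e" "\<beta> \<in> Q e" "\<And>i. coeff e \<alpha> i = coeff e \<beta> i"
  shows "\<alpha> = \<beta>"
  using Q_expansion[OF assms(1)] Q_expansion[OF assms(2)] assms(3) by simp

lemma weight_shift:
  assumes "\<And>i. coeff e \<alpha> i = coeff e \<beta> i + k"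
  shows "weight e \<alpha> = weight e \<beta> + of_int k"
  by (simp add: weight_def assms)

text \<open>Adding \<open>k\<close> to all coefficients keeps the differences and raises \<open>c\<^sub>0\<close>, hence the weight, by \<open>k\<close>.
  As the core from \<open>ex_core_same_differences\<close> has weight zero, the constant by which \<open>\<alpha>\<close> exceeds it is
  the weight of \<open>\<alpha>\<close>, which is thus an integer.\<close>

lemma Q0_iff_weight:
  assumes "e > 0" "\<alpha> \<in> Q e"
  shows "\<alpha> \<in> Q0 e \<longleftrightarrow> 0 \<le> weight e \<alpha>" "\<alpha> \<in> Q0_core e \<longleftrightarrow> weight e \<alpha> = 0"
proof -
  obtain p k where p: "e_core e p" "\<And>i. coeff e \<alpha> i = coeff e (content e p) i + k"
    using ex_core_same_differences[OF assms(1)] by metis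
  have part: "partition p" using p(1) by (simp add: e_core_def)
  have w: "weight e \<alpha> = of_int k"
    using weight_shift[OF p(2)] weight_content_partition(2)[OF part assms(1)] p(1) by simp
  show "\<alpha> \<in> Q0 e \<longleftrightarrow> 0 \<le> weight e \<alpha>"
  proof
    assume "0 \<le> weight e \<alpha>"
    then have k: "int (nat k) = k" using w by simp
    obtain p' where p': "partition p'"
      "\<And>i. coeff e (content e p') i = coeff e (content e p) i + int (nat k)"
      using ex_partition_add_delta[OF part assms(1)] by metis
    have "\<alpha> = content e p'"
      using p'(2) p(2) k by (intro Q_eqI[OF assms(2) content_in_Q[OF assms(1)]]) simp
    then show "\<alpha> \<in> Q0 e" using p'(1) by (auto simp: Q0_def)
  qed (auto simp: Q0_def weight_content_partition assms)
  show "\<alpha> \<in> Q0_core e \<longleftrightarrow> weight e \<alpha> = 0"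
  proof
    assume "weight e \<alpha> = 0"
    then have "\<alpha> = content e p"
      using w p(2) by (intro Q_eqI[OF assms(2) content_in_Q[OF assms(1)]]) simp
    then show "\<alpha> \<in> Q0_core e" using p(1) by (auto simp: Q0_core_def)
  next
    assume "\<alpha> \<in> Q0_core e"
    then show "weight e \<alpha> = 0"
      using weight_content_partition(2)[OF _ assms(1)] by (auto simp: Q0_core_def e_core_def)
  qed
qed

section \<open>Rotation of the residues\<close>

lemma sigma_in_Q:
  assumes "e > 0"
  shows "sigma e e' \<alpha> \<in> Q e"
proof -
  have "Poly_Mapping.keys (sigma e e' \<alpha>)
      \<subseteq> (\<Union>i\<in>Poly_Mapping.keys \<alpha>. Poly_Mapping.keys (simple_root e (i - int e')))"
    unfolding sigma_def by (rule keys_frag_extend)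
  also have "\<dots> \<subseteq> {0..<int e}" using assms by (auto simp: simple_root_def)
  finally show ?thesis by (simp add: Q_def)
qed

lemma coeff_sigma:
  assumes "e > 0" "\<alpha> \<in> Q e"
  shows "coeff e (sigma e e' \<alpha>) i = coeff e \<alpha> (i + int e')"
proof -
  let ?K = "Poly_Mapping.keys \<alpha>" and ?j = "(i + int e') mod int e"
  have K: "?K \<subseteq> {0..<int e}" using assms(2) by (simp add: Q_def)
  have "coeff e (sigma e e' \<alpha>) i
      = (\<Sum>j\<in>?K. Poly_Mapping.lookup \<alpha> j * (if i mod int e = (j - int e') mod int e then 1 else 0))"
    unfolding coeff_def sigma_def frag_extend_def
    by (auto simp: lookup_sum simple_root_def intro!: sum.cong)
  also have "\<dots> = (\<Sum>j\<in>?K. if j = ?j then Poly_Mapping.lookup \<alpha> j else 0)"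
  proof (intro sum.cong refl)
    fix j assume "j \<in> ?K"
    then have "j mod int e = j" using K by auto
    moreover have "i mod int e = (j - int e') mod int e \<longleftrightarrow> (i + int e') mod int e = j mod int e"
      by (simp add: mod_eq_dvd_iff algebra_simps)
    ultimately show "Poly_Mapping.lookup \<alpha> j * (if i mod int e = (j - int e') mod int e then 1 else 0)
      = (if j = ?j then Poly_Mapping.lookup \<alpha> j else 0)" by auto
  qed
  also have "\<dots> = Poly_Mapping.lookup \<alpha> ?j"
    by (simp add: in_keys_iff)
  finally show ?thesis by (simp add: coeff_def)
qed

lemma weight_sigma:
  assumes "e > 0" "\<alpha> \<in> Q e"
  shows "weight e (sigma e e' \<alpha>) = weight e \<alpha> + of_int (coeff e \<alpha> (int e')) - of_int (coeff e \<alpha> 0)"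
proof -
  define f :: "int \<Rightarrow> rat" where
    "f i = (of_int (coeff e \<alpha> i) - of_int (coeff e \<alpha> (i + 1)))\<^sup>2" for i
  have "f (i mod int e) = f i" for i by (simp add: f_def coeff_def mod_add_left_eq)
  then have "(\<Sum>i\<in>{0..<int e}. f (i + int e')) = (\<Sum>i\<in>{0..<int e}. f i)"
    by (rule sum_periodic_shift[OF assms(1)])
  then show ?thesis
    by (simp add: weight_def coeff_sigma[OF assms] f_def add.commute add.left_commute)
qed

theorem corollary4p4:
  fixes e e' :: nat and \<alpha> :: "int \<Rightarrow>\<^sub>0 int"
  assumes "e \<ge> 2" and "e' \<in> {1..e - 1}" and "\<alpha> \<in> Q0 e"
  shows "(sigma e e' \<alpha> \<in> Q0 e \<longleftrightarrow>
            rat_of_int (coeff e \<alpha> 0) \<le> rat_of_int (coeff e \<alpha> (int e')) + weight e \<alpha>) \<and>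
         (rat_of_int (coeff e \<alpha> 0) = rat_of_int (coeff e \<alpha> (int e')) + weight e \<alpha> \<longleftrightarrow>
            sigma e e' \<alpha> \<in> Q0_core e) \<and>
         (\<alpha> \<in> Q0_core e \<longrightarrow>
            (sigma e e' \<alpha> \<in> Q0 e \<longleftrightarrow> coeff e \<alpha> 0 \<le> coeff e \<alpha> (int e')) \<and>
            (coeff e \<alpha> 0 = coeff e \<alpha> (int e') \<longleftrightarrow> sigma e e' \<alpha> \<in> Q0_core e))"
proof -
  have e: "e > 0" using assms(1) by simp
  have \<alpha>: "\<alpha> \<in> Q e" using assms(3) content_in_Q[OF e] by (auto simp: Q0_def)
  show ?thesis
    by (auto simp: Q0_iff_weight[OF e sigma_in_Q[OF e]] Q0_iff_weight[OF e \<alpha>] weight_sigma[OF e \<alpha>])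
qed

end
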